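(* Let $n\ge 4$. For each $i\in\{1,2,3\}$, the $n\times n$ sign pattern $\mathcal{A}_i$ requires $\mathbb{H}_n$, i.e. $\{\mathrm{ri}(B)\mid B\in Q(\mathcal{A}_i)\}=\mathbb{H}_n$, where $\mathbb{H}_n=\{(0,n,0,0),(0,n-2,0,2),(2,n-2,0,0)\}$.
   Context: The refined inertia of a real square matrix $B$ is $\mathrm{ri}(B)=(n_+(B),n_-(B),n_z(B),2n_p(B))$, where $n_+$ (resp. $n_-$) is the number of eigenvalues (with multiplicity) with positive (resp. negative) real part, $n_z$ is the number of zero eigenvalues, and $2n_p$ is the number of nonzero pure imaginary eigenvalues. A sign pattern is a matrix with entries in $\{+,-,0\}$; for an $n\times n$ sign pattern $\mathcal{A}$, $Q(\mathcal{A})$ is the set of real $n\times n$ matrices whose entrywise signs equal $\mathcal{A}$. The $n\times n$ sign patterns ($n\ge 4$) are defined as follows; in all three, every off-diagonal entry not in the first row or first column is $0$, and the $(2,2)$ entry is $0$. $\mathcal{A}_1$: $(1,1)$ entry $+$, entries $(1,j)$ for $j\ge2$ are $+$, entries $(j,1)$ for $j\ge 2$ are $-$, diagonal entries $(j,j)$ for $3\le j\le n$ are $-$. $\mathcal{A}_2$: $(1,1)$ entry $-$, entries $(1,j)$ for $j\ge 2$ are $+$, $(2,1)$ entry $-$, entries $(j,1)$ for $3\le j\le n$ are $+$, diagonal entries $(j,j)$ for $3\le j\le n$ are $-$. $\mathcal{A}_3$: $(1,1)$ entry $-$, entries $(1,j)$ for $j\ge2$ are $+$, entries $(j,1)$ for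 $2\le j\le n-1$ are $+$, $(n,1)$ entry $-$, diagonal entries $(j,j)$ for $3\le j\le n-1$ are $-$, and $(n,n)$ entry $+$. *)

theory Defs
  imports Complex_Main "HOL-Computational_Algebra.Polynomial" "Jordan_Normal_Form.Char_Poly"
begin

text \<open>The multiset of complex eigenvalues of a real matrix, each counted with its
  algebraic multiplicity.\<close>

definition spectrum_mset :: "real mat \<Rightarrow> complex multiset" where
  "spectrum_mset B = proots (char_poly (map_mat complex_of_real B))"

text \<open>The components are \<open>(n\<^sub>+, n\<^sub>-, n\<^sub>z, 2 n\<^sub>p)\<close>; the last one counts the eigenvalues
  themselves, not the conjugate pairs.\<close>

definition refined_inertia :: "real mat \<Rightarrow> nat \<times> nat \<times> nat \<times> nat" where
  "refined_inertia B =
    (size {#z \<in># spectrum_mset B. Re z > 0#},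
     size {#z \<in># spectrum_mset B. Re z < 0#},
     size {#z \<in># spectrum_mset B. z = 0#},
     size {#z \<in># spectrum_mset B. Re z = 0 \<and> z \<noteq> 0#})"

datatype entry_sign = Plus | Minus | Zero

definition entry_sign_of :: "real \<Rightarrow> entry_sign" where
  "entry_sign_of x = (if x > 0 then Plus else if x < 0 then Minus else Zero)"

text \<open>The set usually written \<open>Q(A)\<close>; equality of matrices includes equality of their dimensions.\<close>

definition qual_class :: "entry_sign mat \<Rightarrow> real mat set" where
  "qual_class A = {B. map_mat entry_sign_of B = A}"

definition requires_ri :: "entry_sign mat \<Rightarrow> (nat \<times> nat \<times> nat \<times> nat) set \<Rightarrow> bool" where
  "requires_ri A S \<longleftrightarrow> {refined_inertia B | B. B \<in> qual_class A} = S"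

definition H_set :: "nat \<Rightarrow> (nat \<times> nat \<times> nat \<times> nat) set" where
  "H_set n = {(0, n, 0, 0), (0, n - 2, 0, 2), (2, n - 2, 0, 0)}"

text \<open>Matrix indices start at 0, so the usual entry \<open>(i, j)\<close> is found here at index
  \<open>(i - 1, j - 1)\<close>: the zero diagonal entry \<open>(2, 2)\<close> is at index \<open>(1, 1)\<close>, and the
  nonzero diagonal entries \<open>(j, j)\<close> with \<open>3 \<le> j\<close> are at indices at least 2.\<close>

definition A1 :: "nat \<Rightarrow> entry_sign mat" where
  "A1 n = mat n n (\<lambda>(i, j).
     if i = 0 then Plus
     else if j = 0 then Minus
     else if i = j \<and> 2 \<le> i then Minus
     else Zero)"

definition A2 :: "nat \<Rightarrow> entry_sign mat" where
  "A2 n = mat n n (\<lambda>(i, j).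
     if i = 0 then (if j = 0 then Minus else Plus)
     else if j = 0 then (if i = 1 then Minus else Plus)
     else if i = j \<and> 2 \<le> i then Minus
     else Zero)"

definition A3 :: "nat \<Rightarrow> entry_sign mat" where
  "A3 n = mat n n (\<lambda>(i, j).
     if i = 0 then (if j = 0 then Minus else Plus)
     else if j = 0 then (if i = n - 1 then Minus else Plus)
     else if i = j \<and> 2 \<le> i then (if i = n - 1 then Plus else Minus)
     else Zero)"

end

theory Submission
  imports Defs "HOL-Computational_Algebra.Fundamental_Theorem_Algebra"
begin

text \<open>The matrices in the three classes are stars, so up to the factor \<open>\<Prod>(x - d\<^sub>j)\<close>
  the characteristic polynomial is \<open>x - a - (\<Sum>j. w\<^sub>j / (x - d\<^sub>j))\<close>, where \<open>w\<^sub>j\<close> is the product of the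
  two off-diagonal entries at \<open>j\<close>. Equal poles only contribute negative
  eigenvalues and can be merged. In each pattern there is one pole (the least one for \<open>A\<^sub>1\<close>, \<open>0\<close> for
  \<open>A\<^sub>2\<close>, the positive one for \<open>A\<^sub>3\<close>) such that, by the intermediate value theorem, every other pole
  has an eigenvalue between it and the preceding pole (or \<open>-\<infinity>\<close>). This gives \<open>n - 2\<close> negative
  eigenvalues; the remaining two are the roots of some \<open>x\<^sup>2 + s x + t\<close>, and the sign of the
  determinant forces \<open>t > 0\<close>, so the refined inertia is determined by the sign of \<open>s\<close>. Conversely, all
  three signs occur for matrices with all nonzero diagonal entries outside \<open>(1, 1)\<close> equal to \<open>\<plusminus>1\<close>.\<close>

section \<open>Determinant and characteristic polynomial of a star matrix\<close>

text \<open>Elimination of the first column without division, so that it also works for polynomial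
  entries. Multiplying by \<open>T\<close> on the right scales column 0 by \<open>P\<close> and
  clears it below the corner, leaving an upper triangular matrix with diagonal \<open>?R\<close>,
  \<open>M $$ (1, 1)\<close>, and so on. Since \<open>det T = P\<close> is nonzero, it
  cancels.\<close>

lemma det_star:
  fixes M :: "'a :: idom mat"
  assumes M: "M \<in> carrier_mat n n" and n: "n > 0"
    and off: "\<And>i j. i \<in> {1..<n} \<Longrightarrow> j \<in> {1..<n} \<Longrightarrow> i \<noteq> j \<Longrightarrow> M $$ (i, j) = 0"
    and diag: "\<And>j. j \<in> {1..<n} \<Longrightarrow> M $$ (j, j) \<noteq> 0"
  shows "det M = M $$ (0, 0) * (\<Prod>j\<in>{1..<n}. M $$ (j, j))
    - (\<Sum>j\<in>{1..<n}. M $$ (0, j) * M $$ (j, 0) * (\<Prod>k\<in>{1..<n} - {j}. M $$ (k, k)))"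
    (is "_ = ?R")
proof -
  let ?J = "{1..<n}"
  define P where "P = (\<Prod>j\<in>?J. M $$ (j, j))"
  define Q where "Q j = (\<Prod>k\<in>?J - {j}. M $$ (k, k))" for j
  define T where "T = mat n n (\<lambda>(i, j). if j = 0 then (if i = 0 then P else - M $$ (i, 0) * Q i)
    else if i = j then 1 else 0)"
  have PQ: "P = M $$ (j, j) * Q j" if "j \<in> ?J" for j
    unfolding P_def Q_def using that by (intro prod.remove) auto
  have set_n: "{0..<n} = insert 0 ?J" using n by auto
  have T: "T \<in> carrier_mat n n" by (simp add: T_def)
  have MT: "M * T \<in> carrier_mat n n" using M T by simp
  have entry: "(M * T) $$ (i, j) = M $$ (i, 0) * T $$ (0, j) + (\<Sum>k\<in>?J. M $$ (i, k) * T $$ (k, j))"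
    if "i < n" "j < n" for i j
    using that M T by (simp add: scalar_prod_def set_n)
  have MT_diag: "(M * T) $$ (j, j) = M $$ (j, j)" if "j \<in> ?J" for j
  proof -
    have "(\<Sum>k\<in>?J. M $$ (j, k) * T $$ (k, j)) = (\<Sum>k\<in>?J. if k = j then M $$ (j, j) else 0)"
      using that by (intro sum.cong) (auto simp: T_def)
    then show ?thesis using that by (subst entry) (auto simp: T_def)
  qed
  have MT_0: "(M * T) $$ (0, 0) = ?R"
    using n by (subst entry)
      (simp_all add: T_def P_def Q_def sum_negf mult_ac)
  have MT_low: "(M * T) $$ (i, j) = 0" if "j < i" "i < n" for i j
  proof (cases "j = 0")
    case True
    have "(\<Sum>k\<in>?J. M $$ (i, k) * T $$ (k, j)) = (\<Sum>k\<in>?J. if k = i then - M $$ (i, i) * M $$ (i, 0) * Q i else 0)"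
      using that off True by (intro sum.cong) (auto simp: T_def)
    then show ?thesis using that True PQ[of i] by (subst entry) (auto simp: T_def)
  next
    case False
    have "(\<Sum>k\<in>?J. M $$ (i, k) * T $$ (k, j)) = 0"
      using that off False by (intro sum.neutral) (auto simp: T_def)
    then show ?thesis using that False by (subst entry) (auto simp: T_def)
  qed
  have "det (M * T) = (\<Prod>i\<in>{0..<n}. (M * T) $$ (i, i))"
    using MT MT_low by (subst det_upper_triangular[OF _ MT])
      (auto simp: upper_triangular_def prod_list_diag_prod)
  also have "\<dots> = (M * T) $$ (0, 0) * (\<Prod>i\<in>?J. (M * T) $$ (i, i))"
    unfolding set_n by (subst prod.insert) auto
  also have "(\<Prod>i\<in>?J. (M * T) $$ (i, i)) = P"
    unfolding P_def by (intro prod.cong refl MT_diag)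
  finally have 1: "det (M * T) = ?R * P" by (simp only: MT_0)
  have "det T = (\<Prod>i\<in>{0..<n}. T $$ (i, i))"
    using T by (subst det_lower_triangular[OF _ T]) (auto simp: T_def prod_list_diag_prod)
  also have "\<dots> = T $$ (0, 0) * (\<Prod>i\<in>?J. T $$ (i, i))"
    unfolding set_n by (subst prod.insert) auto
  also have "\<dots> = P" using n by (auto simp: T_def intro!: prod.neutral)
  finally have "det M * P = ?R * P" using 1 det_mult[OF M T] by simp
  moreover have "P \<noteq> 0" unfolding P_def using diag by auto
  ultimately show ?thesis by simp
qed

text \<open>The characteristic polynomial of a matrix whose off-diagonal entries vanish outside the
  first row and column: \<open>a\<close> and \<open>d j\<close> are the diagonal entries, \<open>w j\<close> is the product of
  the two entries linking \<open>j\<close> to the centre. Divided by \<open>\<Prod>(x - d j)\<close>, it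
  is \<open>x - a - (\<Sum>j. w j / (x - d j))\<close>.\<close>

definition star_poly :: "'a :: idom \<Rightarrow> ('i \<Rightarrow> 'a) \<Rightarrow> ('i \<Rightarrow> 'a) \<Rightarrow> 'i set \<Rightarrow> 'a poly" where
  "star_poly a d w J = [:- a, 1:] * (\<Prod>j\<in>J. [:- d j, 1:])
    - (\<Sum>j\<in>J. Polynomial.smult (w j) (\<Prod>k\<in>J - {j}. [:- d k, 1:]))"

text \<open>This is \<open>det_star\<close> over the polynomial ring, where the diagonal entries are
  monic linear and hence nonzero; the minus signs of the two entries linking \<open>j\<close> to the
  centre cancel.\<close>

lemma char_poly_star:
  fixes B :: "'a :: idom mat"
  assumes B: "B \<in> carrier_mat n n" and n: "n > 0"
    and off: "\<And>i j. i \<in> {1..<n} \<Longrightarrow> j \<in> {1..<n} \<Longrightarrow> i \<noteq> j \<Longrightarrow> B $$ (i, j) = 0"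
  shows "char_poly B = star_poly (B $$ (0, 0)) (\<lambda>j. B $$ (j, j)) (\<lambda>j. B $$ (0, j) * B $$ (j, 0)) {1..<n}"
proof -
  let ?M = "char_poly_matrix B"
  have entry: "?M $$ (i, j) = (if i = j then [:- B $$ (i, i), 1:] else [:- B $$ (i, j):])"
    if "i < n" "j < n" for i j
    using that B by (auto simp: char_poly_matrix_def)
  have "det ?M = ?M $$ (0, 0) * (\<Prod>j\<in>{1..<n}. ?M $$ (j, j))
    - (\<Sum>j\<in>{1..<n}. ?M $$ (0, j) * ?M $$ (j, 0) * (\<Prod>k\<in>{1..<n} - {j}. ?M $$ (k, k)))"
    using B n off by (intro det_star) (auto simp: entry)
  then show ?thesis
    using n by (simp add: char_poly_def star_poly_def entry mult.commute[of "B $$ (_, 0)"])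
qed

lemma star_poly_monic:
  assumes "finite J"
  shows "degree (star_poly a d w J) = Suc (card J)" "lead_coeff (star_poly a d w J) = 1"
proof -
  let ?p = "[:- a, 1:] * (\<Prod>j\<in>J. [:- d j, 1:])"
  let ?q = "\<Sum>j\<in>J. Polynomial.smult (w j) (\<Prod>k\<in>J - {j}. [:- d k, 1:])"
  have deg: "degree ?p = Suc (card J)"
    by (subst degree_mult_eq) (auto simp: degree_prod_eq_sum_degree assms)
  have "degree ?q \<le> card J"
  proof (intro degree_sum_le assms)
    fix j assume "j \<in> J"
    have "degree (\<Prod>k\<in>J - {j}. [:- d k, 1:]) \<le> card J"
      by (subst degree_prod_eq_sum_degree) (auto simp: assms card_mono)
    then show "degree (Polynomial.smult (w j) (\<Prod>k\<in>J - {j}. [:- d k, 1:])) \<le> card J"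
      by (meson degree_smult_le order_trans)
  qed
  then have lt: "degree ?q < degree ?p" using deg by simp
  have "star_poly a d w J = ?p + (- ?q)" by (simp add: star_poly_def)
  moreover have "degree (?p + (- ?q)) = degree ?p" using lt by (intro degree_add_eq_left) simp
  ultimately show d: "degree (star_poly a d w J) = Suc (card J)" using deg by simp
  have "lead_coeff ?p = 1" by (simp only: lead_coeff_mult lead_coeff_prod) simp
  then show "lead_coeff (star_poly a d w J) = 1"
    using lt unfolding d deg[symmetric] by (simp add: star_poly_def coeff_eq_0 del: mult_pCons_left)
qed

section \<open>Values at the poles and merging of equal poles\<close>

text \<open>At \<open>d j\<close> every term still containing the factor \<open>x - d j\<close>
  vanishes, so only summand \<open>j\<close> survives. The sign at a pole can thus be read off its
  weight and the position of the other poles.\<close>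

lemma poly_star_poly_pole:
  assumes "finite J" "j \<in> J"
  shows "poly (star_poly a d w J) (d j) = - w j * (\<Prod>k\<in>J - {j}. d j - d k)"
proof -
  have "poly (star_poly a d w J) (d j) = - (\<Sum>i\<in>J. w i * (\<Prod>k\<in>J - {i}. d j - d k))"
    using assms by (auto simp: star_poly_def poly_prod poly_sum)
  also have "(\<Sum>i\<in>J. w i * (\<Prod>k\<in>J - {i}. d j - d k))
      = (\<Sum>i\<in>J. if i = j then w j * (\<Prod>k\<in>J - {j}. d j - d k) else 0)"
    using assms by (intro sum.cong refl) auto
  finally show ?thesis using assms by simp
qed

text \<open>Indices with the same \<open>d\<close>-value form one pole whose weights add up. A
  product omitting one index keeps all but one of the factors of that pole, so each term contains
  every \<open>x - d j\<close> to its multiplicity minus one.\<close>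

lemma star_poly_group:
  fixes d :: "'i \<Rightarrow> 'a :: idom"
  assumes J: "finite J"
  shows "star_poly a d w J = (\<Prod>x\<in>d ` J. [:- x, 1:] ^ (card {j\<in>J. d j = x} - 1))
    * star_poly a (\<lambda>x. x) (\<lambda>x. \<Sum>j | j \<in> J \<and> d j = x. w j) (d ` J)"
proof -
  let ?D = "d ` J" and ?l = "\<lambda>x. [:- x, 1:]"
  define E where "E = (\<Prod>x\<in>?D. ?l x ^ (card {j\<in>J. d j = x} - 1))"
  have "(\<Prod>j\<in>J. ?l (d j)) = (\<Prod>x\<in>?D. \<Prod>j | j \<in> J \<and> d j = x. ?l (d j))"
    using J by (intro prod.group[symmetric]) auto
  also have "\<dots> = (\<Prod>x\<in>?D. ?l x ^ card {j\<in>J. d j = x})" by (intro prod.cong) auto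
  also have "\<dots> = (\<Prod>x\<in>?D. ?l x ^ (card {j\<in>J. d j = x} - 1) * ?l x)"
  proof (intro prod.cong refl)
    fix x assume "x \<in> ?D"
    then have "card {j\<in>J. d j = x} > 0" using J by (auto simp: card_gt_0_iff)
    then show "?l x ^ card {j\<in>J. d j = x} = ?l x ^ (card {j\<in>J. d j = x} - 1) * ?l x"
      by (rule power_minus_mult[symmetric])
  qed
  finally have P: "(\<Prod>j\<in>J. ?l (d j)) = E * (\<Prod>x\<in>?D. ?l x)" by (simp only: E_def prod.distrib)
  have Q: "(\<Prod>k\<in>J - {j}. ?l (d k)) = E * (\<Prod>x\<in>?D - {d j}. ?l x)" if j: "j \<in> J" for j
  proof -
    \<comment> \<open>Restoring the omitted factor reduces the claim to \<open>P\<close>; the factor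
      then cancels in the integral domain.\<close>
    have "?l (d j) * (\<Prod>k\<in>J - {j}. ?l (d k)) = E * (\<Prod>x\<in>?D. ?l x)"
      using P prod.remove[OF J j, of "\<lambda>k. ?l (d k)"] by simp
    also have "(\<Prod>x\<in>?D. ?l x) = ?l (d j) * (\<Prod>x\<in>?D - {d j}. ?l x)"
      using J j by (intro prod.remove) auto
    finally have "?l (d j) * (\<Prod>k\<in>J - {j}. ?l (d k)) = ?l (d j) * (E * (\<Prod>x\<in>?D - {d j}. ?l x))"
      by (simp only: mult.left_commute)
    then show ?thesis by (subst (asm) mult_cancel_left) auto
  qed
  have "(\<Sum>j\<in>J. Polynomial.smult (w j) (\<Prod>k\<in>J - {j}. ?l (d k)))
      = (\<Sum>j\<in>J. E * Polynomial.smult (w j) (\<Prod>x\<in>?D - {d j}. ?l x))"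
    by (intro sum.cong refl) (simp add: Q)
  also have "\<dots> = (\<Sum>x\<in>?D. \<Sum>j | j \<in> J \<and> d j = x. E * Polynomial.smult (w j) (\<Prod>x\<in>?D - {d j}. ?l x))"
    using J by (intro sum.group[symmetric]) auto
  also have "\<dots> = (\<Sum>x\<in>?D. E * Polynomial.smult (\<Sum>j | j \<in> J \<and> d j = x. w j) (\<Prod>y\<in>?D - {x}. ?l y))"
    by (intro sum.cong refl) (auto simp: smult_sum sum_distrib_left intro!: sum.cong)
  finally show ?thesis
    unfolding star_poly_def P E_def[symmetric]
    by (simp only: sum_distrib_left[symmetric] right_diff_distrib mult.left_commute)
qed

interpretation of_real_poly_hom: map_poly_inj_idom_hom complex_of_real ..

section \<open>Real roots in the gaps between poles\<close>

text \<open>For neighbouring poles each further pole \<open>k\<close> lies on the same side of both,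
  so the factors \<open>x - k\<close> and \<open>y - k\<close> agree in sign. Only
  \<open>x - y\<close> against \<open>y - x\<close> remains, which gives opposite signs when the
  weights agree in sign.\<close>

lemma star_poly_sign_change:
  fixes D :: "real set"
  assumes D: "finite D" "x \<in> D" "y \<in> D" "y < x"
    and gap: "\<And>k. k \<in> D \<Longrightarrow> k \<le> y \<or> x \<le> k" and W: "W y * W x > 0"
  shows "poly (star_poly a (\<lambda>x. x) W D) y * poly (star_poly a (\<lambda>x. x) W D) x < 0"
proof -
  let ?p = "star_poly a (\<lambda>x. x) W D"
  have X: "poly ?p x = - W x * ((x - y) * (\<Prod>k\<in>D - {x, y}. x - k))"
    using poly_star_poly_pole[OF D(1,2), of a "\<lambda>x. x" W] D
    by (subst (asm) prod.remove[of _ y]) (auto simp: Diff_insert2[symmetric])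
  have Y: "poly ?p y = - W y * ((y - x) * (\<Prod>k\<in>D - {x, y}. y - k))"
    using poly_star_poly_pole[OF D(1,3), of a "\<lambda>x. x" W] D
    by (subst (asm) prod.remove[of _ x]) (auto simp: Diff_insert2[symmetric] insert_commute)
  have "(\<Prod>k\<in>D - {x, y}. (x - k) * (y - k)) > 0"
  proof (intro prod_pos)
    fix k assume "k \<in> D - {x, y}"
    then have "(k < x \<and> k < y) \<or> (x < k \<and> y < k)" using gap[of k] D by auto
    then show "(x - k) * (y - k) > 0" by (auto simp: zero_less_mult_iff)
  qed
  then have "0 < (x - y)\<^sup>2 * (W y * W x) * (\<Prod>k\<in>D - {x, y}. (x - k) * (y - k))"
    using W D by (intro mult_pos_pos[of "_ * _"] mult_pos_pos[of "_\<^sup>2"]) auto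
  also have "\<dots> = - (poly ?p y * poly ?p x)"
    unfolding X Y prod.distrib by (simp add: power2_eq_square algebra_simps)
  finally show ?thesis by simp
qed

text \<open>The reflected polynomial \<open>q\<close>, with value
  \<open>(-1) ^ degree p * poly p (- y)\<close> at \<open>y\<close>, is monic and therefore
  eventually at least 1.\<close>

lemma monic_poly_at_minus_infinity:
  fixes p :: "real poly"
  assumes "lead_coeff p = 1"
  shows "\<exists>y<x. (-1) ^ degree p * poly p y > 0"
proof -
  define q where "q = Polynomial.smult ((-1) ^ degree p) (pcompose p [:0, -1:])"
  have "lead_coeff q = (-1) ^ degree p * (-1) ^ degree p"
    using assms unfolding q_def lead_coeff_smult by (subst lead_coeff_comp) auto
  then have "lead_coeff q = 1" by (simp add: power_mult_distrib[symmetric])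
  then obtain N where N: "\<And>y. y \<ge> N \<Longrightarrow> poly q y \<ge> 1"
    using poly_pinfty_gt_lc[of q] by auto
  have "poly q (max N (1 - x)) \<ge> 1" by (rule N) simp
  then have "(-1) ^ degree p * poly p (- max N (1 - x)) > 0" by (simp add: q_def poly_pcompose)
  moreover have "- max N (1 - x) < x" by linarith
  ultimately show ?thesis by blast
qed

text \<open>The intermediate value theorem is applied between \<open>x\<close> and the preceding
  pole, or between \<open>x\<close> and a point far to the left if \<open>x\<close> is the least
  pole. The last conjunct says that the root lies in the gap directly below \<open>x\<close>, which
  keeps roots for different poles apart.\<close>

lemma star_poly_root_below:
  fixes D :: "real set"
  assumes D: "finite D" and x: "x \<in> D"
    and W: "\<And>y. y \<in> D \<Longrightarrow> y < x \<Longrightarrow> W y * W x > 0"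
    and W_min: "(\<And>y. y \<in> D \<Longrightarrow> x \<le> y) \<Longrightarrow> W x > 0"
  shows "\<exists>r<x. poly (star_poly a (\<lambda>x. x) W D) r = 0 \<and> (\<forall>y\<in>D. y < x \<longrightarrow> y < r)"
proof (cases "\<exists>y\<in>D. y < x")
  case True
  define y where "y = Max {y \<in> D. y < x}"
  have "y \<in> {y \<in> D. y < x}" unfolding y_def using True D by (intro Max_in) auto
  then have y: "y \<in> D" "y < x" by auto
  have below: "k \<le> y" if "k \<in> D" "k < x" for k using that D by (auto simp: y_def)
  have "poly (star_poly a (\<lambda>x. x) W D) y * poly (star_poly a (\<lambda>x. x) W D) x < 0"
    using D x y below W by (intro star_poly_sign_change) (auto simp: not_less[symmetric])
  from poly_IVT[OF y(2) this] show ?thesis using below by force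
next
  case False
  let ?p = "star_poly a (\<lambda>x. x) W D"
  have min: "x \<le> y" if "y \<in> D" for y using False that by auto
  \<comment> \<open>The degree is \<open>m + 2\<close> and the \<open>m\<close> factors
    \<open>x - k\<close> are all negative, so the two powers of -1 cancel and the sign is that of
    \<open>- W x\<close>.\<close>
  obtain m where m: "card D = Suc m" using x D by (cases "card D") auto
  have "poly ?p x = - W x * (\<Prod>k\<in>D - {x}. - 1 * (k - x))"
    using poly_star_poly_pole[OF D x, of a "\<lambda>x. x" W] by simp
  also have "\<dots> = - W x * ((-1) ^ m * (\<Prod>k\<in>D - {x}. k - x))"
    using D x m by (simp only: prod.distrib prod_constant) simp
  finally have "(-1) ^ degree ?p * poly ?p x = - (W x * (\<Prod>k\<in>D - {x}. k - x))"
    using m D by (simp add: star_poly_monic power_mult_distrib[symmetric] mult_ac)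
  moreover have "(\<Prod>k\<in>D - {x}. k - x) > 0" using min by (intro prod_pos) force
  ultimately have neg: "(-1) ^ degree ?p * poly ?p x < 0" using W_min min by simp
  obtain y where y: "y < x" "(-1) ^ degree ?p * poly ?p y > 0"
    using monic_poly_at_minus_infinity[OF star_poly_monic(2)[OF D]] by blast
  have "((-1) ^ degree ?p * poly ?p y) * ((-1) ^ degree ?p * poly ?p x) < 0"
    using neg y(2) by (rule mult_pos_neg[rotated])
  then have "poly ?p y * poly ?p x < 0"
    by (cases "even (degree ?p)") auto
  from poly_IVT[OF y(1) this] show ?thesis using False by auto
qed

text \<open>Gaps below different poles are disjoint, so choosing one root per pole is
  injective.\<close>

lemma star_poly_roots:
  fixes D :: "real set"
  assumes D: "finite D" and T: "T \<subseteq> D"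
    and W: "\<And>x y. x \<in> T \<Longrightarrow> y \<in> D \<Longrightarrow> y < x \<Longrightarrow> W y * W x > 0"
    and W_min: "\<And>x. x \<in> T \<Longrightarrow> (\<And>y. y \<in> D \<Longrightarrow> x \<le> y) \<Longrightarrow> W x > 0"
  obtains R where "finite R" "card R = card T"
    "\<And>r. r \<in> R \<Longrightarrow> poly (star_poly a (\<lambda>x. x) W D) r = 0" "\<And>r. r \<in> R \<Longrightarrow> \<exists>x\<in>T. r < x"
proof -
  have "\<forall>x\<in>T. \<exists>r<x. poly (star_poly a (\<lambda>x. x) W D) r = 0 \<and> (\<forall>y\<in>D. y < x \<longrightarrow> y < r)"
    using D T W W_min by (intro ballI star_poly_root_below) auto
  then obtain r where r: "\<And>x. x \<in> T \<Longrightarrow> r x < x"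
      "\<And>x. x \<in> T \<Longrightarrow> poly (star_poly a (\<lambda>x. x) W D) (r x) = 0"
      "\<And>x y. x \<in> T \<Longrightarrow> y \<in> D \<Longrightarrow> y < x \<Longrightarrow> y < r x"
    by metis
  have "inj_on r T"
  proof (rule linorder_inj_onI')
    fix x y assume "x \<in> T" "y \<in> T" "x < y"
    then show "r x \<noteq> r y" using r(1)[of x] r(3)[of y x] T by force
  qed
  then show ?thesis
    using r D T by (intro that[of "r ` T"]) (auto simp: card_image intro: finite_subset)
qed

section \<open>Splitting off a quadratic factor\<close>

lemma prod_linear_factors_dvd:
  fixes p :: "'a :: idom poly"
  assumes "finite R" "\<And>r. r \<in> R \<Longrightarrow> poly p r = 0"
  shows "(\<Prod>r\<in>R. [:- r, 1:]) dvd p"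
  using assms
proof (induction R arbitrary: p)
  case (insert r R)
  then obtain q where q: "p = [:- r, 1:] * q" using poly_eq_0_iff_dvd[of p r] by auto
  have "(\<Prod>r\<in>R. [:- r, 1:]) dvd q" using insert.prems insert.hyps by (intro insert.IH) (force simp: q)
  then have "[:- r, 1:] * (\<Prod>r\<in>R. [:- r, 1:]) dvd [:- r, 1:] * q" by (intro mult_dvd_mono dvd_refl)
  then show ?case unfolding q using insert.hyps by (simp only: prod.insert[OF insert.hyps])
qed simp

lemma monic_quadratic:
  fixes q :: "'a :: comm_ring_1 poly"
  assumes "degree q = 2" "lead_coeff q = 1"
  shows "q = [:coeff q 0, coeff q 1, 1:]"
  using assms by (intro poly_eqI) (auto simp: coeff_pCons coeff_eq_0 numeral_2_eq_2 split: nat.splits)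

text \<open>Apart from \<open>z\<close>, every pole contributes a root just below it; this leaves a quadratic factor.\<close>

lemma star_poly_split:
  fixes d w :: "'i \<Rightarrow> real"
  assumes J: "finite J" and z: "z \<in> d ` J"
    and nonpos: "\<And>j. j \<in> J \<Longrightarrow> d j \<noteq> z \<Longrightarrow> d j \<le> 0"
    and mult: "\<And>i j. i \<in> J \<Longrightarrow> j \<in> J \<Longrightarrow> i \<noteq> j \<Longrightarrow> d i = d j \<Longrightarrow> d i < 0"
    and w: "\<And>i j. i \<in> J \<Longrightarrow> j \<in> J \<Longrightarrow> d j \<noteq> z \<Longrightarrow> d i < d j \<Longrightarrow> w i * w j > 0"
    and w_min: "\<And>j. j \<in> J \<Longrightarrow> d j \<noteq> z \<Longrightarrow> (\<And>i. i \<in> J \<Longrightarrow> d j \<le> d i) \<Longrightarrow> w j > 0"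
    and pos: "poly (star_poly a d w J) 0 > 0"
  obtains h s t where "star_poly a d w J = h * [:t, s, 1:]" "t > 0"
    "\<And>c. poly (map_poly complex_of_real h) c = 0 \<Longrightarrow> Re c < 0"
proof -
  let ?D = "d ` J" and ?W = "\<lambda>x. \<Sum>j | j \<in> J \<and> d j = x. w j"
  let ?p = "star_poly a (\<lambda>x. x) ?W ?D" and ?m = "\<lambda>x. card {j\<in>J. d j = x} - 1"
  define E where "E = (\<Prod>x\<in>?D. [:- x, 1:] ^ ?m x)"
  have D: "finite ?D" using J by simp
  have Ep: "star_poly a d w J = E * ?p" unfolding E_def by (rule star_poly_group[OF J])
  obtain R where R: "finite R" "card R = card (?D - {z})" "\<And>r. r \<in> R \<Longrightarrow> poly ?p r = 0"
      "\<And>r. r \<in> R \<Longrightarrow> \<exists>x\<in>?D - {z}. r < x"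
  proof (rule star_poly_roots[OF D, of "?D - {z}" ?W a])
    fix x y assume xy: "x \<in> ?D - {z}" "y \<in> ?D" "y < x"
    \<comment> \<open>The sign condition passes to merged weights, since their product expands into
      a double sum of positive terms.\<close>
    have "(\<Sum>i | i \<in> J \<and> d i = y. \<Sum>j | j \<in> J \<and> d j = x. w i * w j) > 0"
      using J xy w by (intro sum_pos) auto
    then show "?W y * ?W x > 0" by (simp only: sum_product)
  next
    fix x assume "x \<in> ?D - {z}" "\<And>y. y \<in> ?D \<Longrightarrow> x \<le> y"
    then show "?W x > 0" using J w_min by (intro sum_pos) auto
  qed auto
  have Rneg: "r < 0" if "r \<in> R" for r using R(4)[OF that] nonpos by force
  define P where "P = (\<Prod>r\<in>R. [:- r, 1:])"
  obtain q where q: "?p = P * q"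
    using prod_linear_factors_dvd[OF R(1,3)] unfolding P_def by auto
  have Pm: "lead_coeff P = 1" "degree P = card R"
    unfolding P_def by (simp only: lead_coeff_prod, simp, subst degree_prod_eq_sum_degree, auto)
  have "lead_coeff ?p = lead_coeff P * lead_coeff q" unfolding q by (rule lead_coeff_mult)
  then have qm: "lead_coeff q = 1" unfolding star_poly_monic(2)[OF D] Pm(1) by simp
  have "degree ?p = degree P + degree q" unfolding q using Pm qm by (intro degree_mult_eq) auto
  moreover have "card ?D = Suc (card (?D - {z}))" using D z by (metis card_Suc_Diff1)
  moreover have "degree ?p = Suc (card ?D)" by (rule star_poly_monic(1)[OF D])
  \<comment> \<open>With k distinct poles, \<open>?p\<close> has degree k + 1 and the roots in
    \<open>R\<close> account for k - 1 of it.\<close>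
  ultimately have "degree q = 2" using Pm R(2) by simp
  from monic_quadratic[OF this qm] obtain s t where st: "q = [:t, s, 1:]" by blast
  \<comment> \<open>A positive exponent means that two indices share the pole, so
    \<open>mult\<close> applies.\<close>
  have Eneg: "x < 0" if "x \<in> ?D" "?m x > 0" for x
  proof -
    have "\<not> card {j\<in>J. d j = x} \<le> Suc 0" using that by simp
    then show ?thesis using J mult by (subst (asm) card_le_Suc0_iff_eq) auto
  qed
  have cpoly: "poly (map_poly complex_of_real (E * P)) c
      = (\<Prod>x\<in>?D. (c - of_real x) ^ ?m x) * (\<Prod>r\<in>R. c - of_real r)" for c
    unfolding E_def P_def of_real_poly_hom.hom_mult of_real_poly_hom.hom_prod of_real_poly_hom.hom_power
      poly_mult poly_prod poly_power by simp
  show ?thesis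
  proof (rule that[of "E * P" t s])
    show "star_poly a d w J = E * P * [:t, s, 1:]" by (simp only: Ep q st mult.assoc)
    \<comment> \<open>At 0 all factors other than \<open>t\<close> are positive, so \<open>t\<close>
      inherits the sign given by \<open>pos\<close>.\<close>
    have p0: "poly (star_poly a d w J) 0 = (\<Prod>x\<in>?D. (- x) ^ ?m x) * (\<Prod>r\<in>R. - r) * t"
      by (simp only: Ep q st E_def P_def poly_mult poly_prod poly_power) simp
    have E0: "(\<Prod>x\<in>?D. (- x) ^ ?m x) > 0"
    proof (intro prod_pos)
      fix x assume "x \<in> ?D"
      then show "(- x) ^ ?m x > 0" using Eneg[of x] by (cases "?m x = 0") auto
    qed
    have P0: "(\<Prod>r\<in>R. - r) > 0" using Rneg by (intro prod_pos) auto
    show "t > 0" using pos unfolding p0 by (rule zero_less_mult_pos) (intro mult_pos_pos E0 P0)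
    fix c assume "poly (map_poly complex_of_real (E * P)) c = 0"
    then show "Re c < 0" unfolding cpoly using D R(1) Eneg Rneg by auto
  qed
qed

section \<open>Refined inertia from the factorisation\<close>

text \<open>The roots have sum \<open>- s\<close> and product \<open>t > 0\<close>. If they are
  real, they share a sign, which must be that of \<open>- s\<close>; otherwise the product being
  real forces equal real parts \<open>- s / 2\<close>.\<close>

lemma quadratic_roots:
  fixes s t :: real
  assumes t: "t > 0"
  obtains z1 z2 where "map_poly complex_of_real [:t, s, 1:] = [:- z1, 1:] * [:- z2, 1:]"
    "sgn (Re z1) = - sgn s" "sgn (Re z2) = - sgn s" "z1 \<noteq> 0" "z2 \<noteq> 0"
proof -
  obtain z1 where "poly [:of_real t, of_real s, 1:] z1 = (0 :: complex)"
    using alg_closed_imp_poly_has_root[of "[:of_real t, of_real s, 1 :: complex:]"] by auto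
  then have z1: "t + s * z1 + z1 * z1 = 0" by (simp add: algebra_simps)
  define z2 where "z2 = - s - z1"
  have "z1 * z2 = t - (t + s * z1 + z1 * z1)" by (simp add: z2_def algebra_simps)
  then have prod: "z1 * z2 = of_real t" using z1 by simp
  have "map_poly complex_of_real [:t, s, 1:] = [:- z1, 1:] * [:- z2, 1:]"
  proof -
    have "[:- z1, 1:] * [:- z2, 1:] = [:z1 * z2, - (z1 + z2), 1:]" by simp
    also have "\<dots> = [:of_real t, of_real s, 1:]" unfolding prod by (simp add: z2_def)
    finally show ?thesis by (simp add: map_poly_pCons)
  qed
  moreover have "sgn (Re z1) = - sgn s \<and> sgn (Re z2) = - sgn s"
  proof (cases "Im z1 = 0")
    case True
    then have "Re z1 * Re z2 = t" using prod by (simp add: z2_def complex_eq_iff)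
    then have "(Re z1 > 0 \<and> Re z2 > 0) \<or> (Re z1 < 0 \<and> Re z2 < 0)" using t by (metis zero_less_mult_iff)
    moreover have "Re z1 + Re z2 = - s" by (simp add: z2_def)
    ultimately show ?thesis by (auto simp: sgn_if)
  next
    case False
    have "Im z1 * (Re z2 - Re z1) = Im (z1 * z2)" by (simp add: z2_def algebra_simps)
    then have "Re z2 = Re z1" using False by (simp add: prod)
    moreover have "Re z1 + Re z2 = - s" by (simp add: z2_def)
    ultimately have "Re z1 = - s / 2" "Re z2 = - s / 2" by auto
    then show ?thesis by (simp add: sgn_if)
  qed
  moreover have "z1 \<noteq> 0" "z2 \<noteq> 0" using prod t by auto
  ultimately show ?thesis using that by blast
qed

text \<open>The factor \<open>h\<close> has degree \<open>n - 2\<close> and supplies only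
  eigenvalues with negative real part. The other two have real parts with the sign of
  \<open>- s\<close>; for \<open>s = 0\<close> they are purely imaginary, and nonzero because
  \<open>t > 0\<close>.\<close>

lemma refined_inertia_split:
  assumes B: "B \<in> carrier_mat n n" and split: "char_poly B = h * [:t, s, 1:]" and t: "t > 0"
    and h: "\<And>c. poly (map_poly complex_of_real h) c = 0 \<Longrightarrow> Re c < 0"
  shows "refined_inertia B =
    (if s < 0 then (2, n - 2, 0, 0) else if s = 0 then (0, n - 2, 0, 2) else (0, n, 0, 0))"
proof -
  let ?h = "map_poly complex_of_real h"
  obtain z1 z2 where z: "map_poly complex_of_real [:t, s, 1:] = [:- z1, 1:] * [:- z2, 1:]"
    "sgn (Re z1) = - sgn s" "sgn (Re z2) = - sgn s" "z1 \<noteq> 0" "z2 \<noteq> 0"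
    using quadratic_roots[OF t] .
  have deg: "degree (h * [:t, s, 1:]) = n" using degree_monic_char_poly[OF B] split by simp
  have "h \<noteq> 0"
  proof
    assume "h = 0"
    then have "poly ?h 0 = 0" by simp
    from h[OF this] show False by simp
  qed
  then have "degree (h * [:t, s, 1:]) = degree h + degree [:t, s, 1:]" by (intro degree_mult_eq) auto
  with deg \<open>h \<noteq> 0\<close> have n: "n = degree h + 2" "?h \<noteq> 0" by simp_all
  have "map_poly complex_of_real (char_poly B) = ?h * ([:- z1, 1:] * [:- z2, 1:])"
    unfolding split z(1)[symmetric] by (rule of_real_poly_hom.hom_mult)
  then have "spectrum_mset B = proots (?h * ([:- z1, 1:] * [:- z2, 1:]))"
    unfolding spectrum_mset_def of_real_hom.char_poly_hom[OF B] by simp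
  also have "\<dots> = proots ?h + {#z1, z2#}"
    using n(2) by (subst proots_mult; (subst proots_mult)?) auto
  finally have spec: "spectrum_mset B = proots ?h + {#z1, z2#}" .
  have neg: "Re c < 0" if "c \<in># proots ?h" for c using that h n(2) by (auto simp: set_count_proots)
  have all: "filter_mset (\<lambda>c. Re c < 0) (proots ?h) = proots ?h"
    by (rule filter_mset_cong[THEN trans, OF refl _ filter_mset_True]) (use neg in auto)
  have none: "filter_mset (\<lambda>c. Re c > 0) (proots ?h) = {#}" "filter_mset (\<lambda>c. c = 0) (proots ?h) = {#}"
    "filter_mset (\<lambda>c. Re c = 0 \<and> c \<noteq> 0) (proots ?h) = {#}"
    using neg by (fastforce)+
  have "size (proots ?h) = n - 2" using n(1) by (simp add: size_proots_complex)
  then show ?thesis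
    using z(2-5) n(1) unfolding refined_inertia_def spec
    by (auto simp: all none sgn_if split: if_splits)
qed

text \<open>Reduces a pattern to sign checks on poles and weights, with \<open>z\<close> the
  exceptional pole. As index 1 has pole 0, the expression in \<open>pos\<close> is the value of the
  characteristic polynomial at 0.\<close>

lemma star_refined_inertia_in_H_set:
  fixes B :: "real mat"
  assumes B: "B \<in> carrier_mat n n" and n: "n \<ge> 2"
    and off: "\<And>i j. i \<in> {1..<n} \<Longrightarrow> j \<in> {1..<n} \<Longrightarrow> i \<noteq> j \<Longrightarrow> B $$ (i, j) = 0"
    and d: "d = (\<lambda>j. B $$ (j, j))" and w: "w = (\<lambda>j. B $$ (0, j) * B $$ (j, 0))"
    and d1: "d 1 = 0" and pos: "- w 1 * (\<Prod>k\<in>{1..<n} - {1}. - d k) > 0"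
    and z: "z \<in> d ` {1..<n}"
    and nonpos: "\<And>j. j \<in> {1..<n} \<Longrightarrow> d j \<noteq> z \<Longrightarrow> d j \<le> 0"
    and mult: "\<And>i j. i \<in> {1..<n} \<Longrightarrow> j \<in> {1..<n} \<Longrightarrow> i \<noteq> j \<Longrightarrow> d i = d j \<Longrightarrow> d i < 0"
    and w_same: "\<And>i j. i \<in> {1..<n} \<Longrightarrow> j \<in> {1..<n} \<Longrightarrow> d j \<noteq> z \<Longrightarrow> d i < d j \<Longrightarrow> w i * w j > 0"
    and w_min: "\<And>j. j \<in> {1..<n} \<Longrightarrow> d j \<noteq> z \<Longrightarrow> (\<And>i. i \<in> {1..<n} \<Longrightarrow> d j \<le> d i) \<Longrightarrow> w j > 0"
  shows "refined_inertia B \<in> H_set n"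
proof -
  have char: "char_poly B = star_poly (B $$ (0, 0)) d w {1..<n}"
    using char_poly_star[OF B _ off] n by (simp add: d w)
  have pos0: "poly (star_poly (B $$ (0, 0)) d w {1..<n}) 0 > 0"
    using poly_star_poly_pole[of "{1..<n}" 1 "B $$ (0, 0)" d w] n pos unfolding d1 by simp
  show ?thesis
  proof (rule star_poly_split[where J = "{1..<n}" and z = z and d = d and w = w and a = "B $$ (0, 0)"])
    fix h s t
    assume "star_poly (B $$ (0, 0)) d w {1..<n} = h * [:t, s, 1:]" "t > 0"
      "\<And>c. poly (map_poly complex_of_real h) c = 0 \<Longrightarrow> Re c < 0"
    from refined_inertia_split[OF B this[folded char]] show ?thesis by (simp add: H_set_def)
  qed (fact finite_atLeastLessThan z nonpos mult w_same w_min pos0)+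
qed

section \<open>Every matrix of the three patterns has an inertia in \<open>H_set n\<close>\<close>

lemma qual_class_iff:
  assumes "A \<in> carrier_mat n n"
  shows "B \<in> qual_class A \<longleftrightarrow>
    B \<in> carrier_mat n n \<and> (\<forall>i<n. \<forall>j<n. entry_sign_of (B $$ (i, j)) = A $$ (i, j))"
proof -
  have "map_mat entry_sign_of B = A \<longleftrightarrow> B \<in> carrier_mat n n \<and> (\<forall>i<n. \<forall>j<n. entry_sign_of (B $$ (i, j)) = A $$ (i, j))"
    using assms by (auto intro!: eq_matI)
  then show ?thesis by (simp add: qual_class_def)
qed

lemma entry_sign_of_iff [simp]:
  "entry_sign_of x = Plus \<longleftrightarrow> x > 0" "entry_sign_of x = Minus \<longleftrightarrow> x < 0" "entry_sign_of x = Zero \<longleftrightarrow> x = 0"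
  by (auto simp: entry_sign_of_def)

lemma A_carrier [simp]: "A1 n \<in> carrier_mat n n" "A2 n \<in> carrier_mat n n" "A3 n \<in> carrier_mat n n"
  by (simp_all add: A1_def A2_def A3_def)

text \<open>All weights are negative, so any two have positive product. Only the condition on the
  least pole could fail, hence that pole is taken as the exceptional one.\<close>

lemma A1_refined_inertia:
  assumes n: "n \<ge> 4" and B: "B \<in> qual_class (A1 n)"
  shows "refined_inertia B \<in> H_set n"
proof -
  define d where "d = (\<lambda>j. B $$ (j, j))"
  define w where "w = (\<lambda>j. B $$ (0, j) * B $$ (j, 0))"
  have Bn: "B \<in> carrier_mat n n" and sgn: "\<And>i j. i < n \<Longrightarrow> j < n \<Longrightarrow> entry_sign_of (B $$ (i, j)) = A1 n $$ (i, j)"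
    using B by (simp_all add: qual_class_iff[OF A_carrier(1)])
  have d1: "d 1 = 0" using sgn[of 1 1] n by (simp add: A1_def d_def)
  have dj: "d j < 0" if "j \<in> {1..<n}" "j \<noteq> 1" for j using sgn[of j j] that by (simp add: A1_def d_def)
  have w: "w j < 0" if "j \<in> {1..<n}" for j
    using sgn[of 0 j] sgn[of j 0] that by (simp add: A1_def w_def mult_less_0_iff)
  have min: "Min (d ` {1..<n}) \<in> d ` {1..<n}" using n by (intro Min_in) auto
  show ?thesis
  proof (rule star_refined_inertia_in_H_set[OF Bn _ _ _ _ d1 _ min, of w])
    fix i j assume "i \<in> {1..<n}" "j \<in> {1..<n}" "i \<noteq> j"
    then show "B $$ (i, j) = 0" using sgn[of i j] by (simp add: A1_def)
  next
    have "(\<Prod>k\<in>{1..<n} - {1}. - d k) > 0" by (intro prod_pos) (use dj in auto)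
    then show "- w 1 * (\<Prod>k\<in>{1..<n} - {1}. - d k) > 0" using w[of 1] n by (intro mult_pos_pos) auto
  next
    fix j assume j: "j \<in> {1..<n}" "d j \<noteq> Min (d ` {1..<n})" "\<And>i. i \<in> {1..<n} \<Longrightarrow> d j \<le> d i"
    then have "d j = Min (d ` {1..<n})" by (intro Min_eqI[symmetric]) auto
    with j show "w j > 0" by simp
  next
    fix i j assume "i \<in> {1..<n}" "j \<in> {1..<n}"
    then show "w i * w j > 0" using w by (intro mult_neg_neg)
  next
    fix j assume "j \<in> {1..<n}"
    then show "d j \<le> 0" using dj[of j] d1 by (cases "j = 1") auto
  next
    fix i j assume "i \<in> {1..<n}" "j \<in> {1..<n}" "i \<noteq> j" "d i = d j"
    then show "d i < 0" using dj[of j] dj[of i] by (cases "j = 1") auto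
  qed (use n d_def w_def in auto)
qed

text \<open>The only negative weight sits at index 1, whose pole 0 is the greatest one. Taking 0 as
  exceptional leaves positive weights at all other poles and below them.\<close>

lemma A2_refined_inertia:
  assumes n: "n \<ge> 4" and B: "B \<in> qual_class (A2 n)"
  shows "refined_inertia B \<in> H_set n"
proof -
  define d where "d = (\<lambda>j. B $$ (j, j))"
  define w where "w = (\<lambda>j. B $$ (0, j) * B $$ (j, 0))"
  have Bn: "B \<in> carrier_mat n n" and sgn: "\<And>i j. i < n \<Longrightarrow> j < n \<Longrightarrow> entry_sign_of (B $$ (i, j)) = A2 n $$ (i, j)"
    using B by (simp_all add: qual_class_iff[OF A_carrier(2)])
  have d1: "d 1 = 0" using sgn[of 1 1] n by (simp add: A2_def d_def)
  have dj: "d j < 0" if "j \<in> {1..<n}" "j \<noteq> 1" for j using sgn[of j j] that by (simp add: A2_def d_def)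
  have w1: "w 1 < 0"
    using sgn[of 0 1] sgn[of 1 0] n by (simp add: A2_def w_def mult_less_0_iff)
  have w: "w j > 0" if "j \<in> {1..<n}" "j \<noteq> 1" for j
    using sgn[of 0 j] sgn[of j 0] that by (simp add: A2_def w_def)
  have z: "0 \<in> d ` {1..<n}" using d1 n by (intro image_eqI[of _ _ 1]) auto
  have not1: "j \<noteq> 1" if "d j \<noteq> 0" for j using that d1 by auto
  show ?thesis
  proof (rule star_refined_inertia_in_H_set[OF Bn _ _ _ _ d1 _ z, of w])
    fix i j assume "i \<in> {1..<n}" "j \<in> {1..<n}" "i \<noteq> j"
    then show "B $$ (i, j) = 0" using sgn[of i j] by (simp add: A2_def)
  next
    have "(\<Prod>k\<in>{1..<n} - {1}. - d k) > 0" by (intro prod_pos) (use dj in auto)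
    then show "- w 1 * (\<Prod>k\<in>{1..<n} - {1}. - d k) > 0" using w1 by (intro mult_pos_pos) auto
  next
    fix j assume "j \<in> {1..<n}" "d j \<noteq> 0"
    then show "w j > 0" "d j \<le> 0" using w[OF _ not1] dj[OF _ not1] by force+
  next
    fix i j assume ij: "i \<in> {1..<n}" "j \<in> {1..<n}" "d j \<noteq> 0" "d i < d j"
    then have "d j < 0" using dj[OF _ not1] by blast
    then show "w i * w j > 0" using ij w[OF _ not1] by (intro mult_pos_pos) auto
  next
    fix i j assume "i \<in> {1..<n}" "j \<in> {1..<n}" "i \<noteq> j" "d i = d j"
    then show "d i < 0" using dj[of j] dj[of i] by (cases "j = 1") auto
  qed (use n d_def w_def in auto)
qed

text \<open>The only negative weight sits at index \<open>n - 1\<close>, whose pole is the only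
  positive one and is taken as exceptional. In the value at 0 the negative factor
  \<open>- d (n - 1)\<close> is compensated by \<open>w 1 > 0\<close>.\<close>

lemma A3_refined_inertia:
  assumes n: "n \<ge> 4" and B: "B \<in> qual_class (A3 n)"
  shows "refined_inertia B \<in> H_set n"
proof -
  define d where "d = (\<lambda>j. B $$ (j, j))"
  define w where "w = (\<lambda>j. B $$ (0, j) * B $$ (j, 0))"
  have Bn: "B \<in> carrier_mat n n" and sgn: "\<And>i j. i < n \<Longrightarrow> j < n \<Longrightarrow> entry_sign_of (B $$ (i, j)) = A3 n $$ (i, j)"
    using B by (simp_all add: qual_class_iff[OF A_carrier(3)])
  have d1: "d 1 = 0" using sgn[of 1 1] n by (simp add: A3_def d_def)
  have dl: "d (n - 1) > 0" 
  proof -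
    have "n - 1 < n" "2 \<le> n - 1" using n by auto
    then show ?thesis using sgn[of "n - 1" "n - 1"] n by (auto simp: A3_def d_def split: if_splits)
  qed
  have dj: "d j < 0" if "j \<in> {1..<n}" "j \<noteq> 1" "j \<noteq> n - 1" for j
    using sgn[of j j] that by (simp add: A3_def d_def)
  have w: "w j > 0" if "j \<in> {1..<n}" "j \<noteq> n - 1" for j
    using sgn[of 0 j] sgn[of j 0] that by (simp add: A3_def w_def)
  have z: "d (n - 1) \<in> d ` {1..<n}" using n by (intro imageI) auto
  have le: "d j \<le> 0" if "j \<in> {1..<n}" "j \<noteq> n - 1" for j using dj[OF that(1) _ that(2)] d1 by (cases "j = 1") auto
  show ?thesis
  proof (rule star_refined_inertia_in_H_set[OF Bn _ _ _ _ d1 _ z, of w])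
    fix i j assume "i \<in> {1..<n}" "j \<in> {1..<n}" "i \<noteq> j"
    then show "B $$ (i, j) = 0" using sgn[of i j] by (simp add: A3_def)
  next
    have "(\<Prod>k\<in>{1..<n} - {1} - {n - 1}. - d k) > 0" by (intro prod_pos) (use dj in auto)
    moreover have "(\<Prod>k\<in>{1..<n} - {1}. - d k) = - d (n - 1) * (\<Prod>k\<in>{1..<n} - {1} - {n - 1}. - d k)"
      using n by (intro prod.remove) auto
    ultimately have "(\<Prod>k\<in>{1..<n} - {1}. - d k) < 0" using dl by (simp add: mult_less_0_iff)
    then show "- w 1 * (\<Prod>k\<in>{1..<n} - {1}. - d k) > 0" using w[of 1] n by (intro mult_neg_neg) auto
  next
    fix j assume "j \<in> {1..<n}" "d j \<noteq> d (n - 1)"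
    then show "w j > 0" "d j \<le> 0" using w[of j] le[of j] by auto
  next
    fix i j assume ij: "i \<in> {1..<n}" "j \<in> {1..<n}" "d j \<noteq> d (n - 1)" "d i < d j"
    then have "j \<noteq> n - 1" by auto
    moreover from this have "d j \<le> 0" using ij le by blast
    then have "i \<noteq> n - 1" using ij(4) dl by auto
    ultimately show "w i * w j > 0" using ij w by (intro mult_pos_pos) auto
  next
    fix i j assume "i \<in> {1..<n}" "j \<in> {1..<n}" "i \<noteq> j" "d i = d j"
    then show "d i < 0" using dj[of j] dj[of i] le[of i] le[of j] dl d1
      by (cases "i = n - 1"; cases "j = n - 1"; cases "j = 1") auto
  qed (use n d_def w_def in auto)
qed

section \<open>Realisation of all three inertias\<close>

text \<open>A family of matrices indexed by the middle coefficient \<open>s\<close> of the quadratic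
  factor suffices: -1/4, 0 and 1/4 give the three inertias, and the bound on \<open>s\<close> is
  small enough to fix the signs of all entries of the families below.\<close>

lemma requires_ri_H_setI:
  assumes "\<And>B. B \<in> qual_class A \<Longrightarrow> refined_inertia B \<in> H_set n"
    and ex: "\<And>s :: real. \<bar>s\<bar> \<le> 1 / 4 \<Longrightarrow> \<exists>B \<in> qual_class A. refined_inertia B =
      (if s < 0 then (2, n - 2, 0, 0) else if s = 0 then (0, n - 2, 0, 2) else (0, n, 0, 0))"
  shows "requires_ri A (H_set n)"
  unfolding requires_ri_def
proof (intro equalityI subsetI)
  let ?ri = "\<lambda>s :: real. if s < 0 then (2, n - 2, 0, 0) else if s = 0 then (0, n - 2, 0, 2) else (0, n, 0, 0)"
  fix x assume "x \<in> H_set n"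
  then have "x \<in> ?ri ` {- 1 / 4, 0, 1 / 4}" by (simp add: H_set_def disj_commute)
  then obtain s where s: "s \<in> {- 1 / 4, 0, 1 / 4}" "x = ?ri s" by (rule imageE)
  then have "\<bar>s\<bar> \<le> 1 / 4" by auto
  from ex[OF this] show "x \<in> {refined_inertia B |B. B \<in> qual_class A}"
    unfolding s(2)[symmetric] by blast
qed (use assms(1) in auto)

text \<open>Ones in the first row make \<open>c i\<close> both the entry in the first column and the
  weight of index \<open>i\<close>.\<close>

definition star_mat :: "nat \<Rightarrow> real \<Rightarrow> (nat \<Rightarrow> real) \<Rightarrow> (nat \<Rightarrow> real) \<Rightarrow> real mat" where
  "star_mat n a d c = mat n n (\<lambda>(i, j).
     if i = 0 then (if j = 0 then a else 1) else if j = 0 then c i else if i = j then d i else 0)"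

lemma star_mat_carrier [simp]: "star_mat n a d c \<in> carrier_mat n n"
  by (simp add: star_mat_def)

lemma char_poly_star_mat:
  assumes "n > 0"
  shows "char_poly (star_mat n a d c) = star_poly a d c {1..<n}"
proof -
  have "char_poly (star_mat n a d c) = star_poly (star_mat n a d c $$ (0, 0)) (\<lambda>j. star_mat n a d c $$ (j, j))
      (\<lambda>j. star_mat n a d c $$ (0, j) * star_mat n a d c $$ (j, 0)) {1..<n}"
    using assms by (intro char_poly_star) (auto simp: star_mat_def)
  also have "\<dots> = star_poly a d c {1..<n}"
    using assms unfolding star_poly_def
    by (intro arg_cong2[of _ _ _ _ "(-)"] arg_cong2[of _ _ _ _ "(*)"] prod.cong sum.cong arg_cong2[of _ _ _ _ Polynomial.smult])
      (auto simp: star_mat_def)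
  finally show ?thesis .
qed

text \<open>With all nonzero poles at \<open>-1\<close> the polynomial is \<open>(x + 1)^(n - 3)\<close> times a cubic. The
  weights are the partial fraction coefficients making this cubic \<open>(x + r)(x\<^sup>2 + s x + 1)\<close>.\<close>

lemma star_poly_two_poles:
  fixes r s :: real
  assumes n: "n \<ge> 4"
  defines "d \<equiv> (\<lambda>j. if j = 1 then 0 else - 1)"
    and "c \<equiv> (\<lambda>j. if j = 1 then - r else (r - 1) * (2 - s) / (real n - 2))"
  shows "star_poly (1 - r - s) d c {1..<n} = ([:1, 1:] ^ (n - 3) * [:r, 1:]) * [:1, s, 1:]"
proof -
  have fib: "{j \<in> {1..<n}. d j = 0} = {1}" "{j \<in> {1..<n}. d j = - 1} = {2..<n}"
    using n by (auto simp: d_def)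
  have "d ` {1..<n} = insert (d 1) (d ` {2..<n})"
    using n unfolding image_insert[symmetric] by (intro arg_cong[of _ _ "image d"]) auto
  also have "d ` {2..<n} = (\<lambda>_. - 1) ` {2..<n}" by (intro image_cong) (auto simp: d_def)
  also have "d 1 = 0" by (simp add: d_def)
  finally have img: "d ` {1..<n} = {0, - 1}" using n by (simp add: image_constant_conv)
  \<comment> \<open>The weight of the pole -1 is shared evenly by its n - 2 indices. Comparing
    values with the target cubic at 0 and -1 gives the totals \<open>- r\<close> and
    \<open>(r - 1) * (2 - s)\<close>; its x^2 coefficient gives the corner entry.\<close>
  have sums: "sum c {1} = - r" "sum c {2..<n} = (r - 1) * (2 - s)" using n by (auto simp: c_def of_nat_diff)
  define W where "W x = (\<Sum>j | j \<in> {1..<n} \<and> d j = x. c j)" for x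
  have W: "W 0 = - r" "W (- 1) = (r - 1) * (2 - s)" unfolding W_def fib sums by (rule refl)+
  have cubic: "star_poly (1 - r - s) (\<lambda>x. x) W {0, - 1} = [:r, 1:] * [:1, s, 1:]"
    by (simp add: star_poly_def W insert_Diff_if algebra_simps)
  have "(\<Prod>x\<in>{0, - 1 :: real}. [:- x, 1:] ^ (card {j \<in> {1..<n}. d j = x} - 1)) = [:1, 1:] ^ (n - 3)"
    using n by (subst prod.insert; simp add: fib del: One_nat_def atLeastLessThan_iff)
  then show ?thesis
    unfolding star_poly_group[OF finite_atLeastLessThan] img W_def[symmetric] cubic by (simp only: mult.assoc)
qed

text \<open>The same computation with a further pole at \<open>1\<close> and target
  \<open>(x + 1)^(n - 4) (x + 1/2)(x + 2)(x\<^sup>2 + s x + 1)\<close>.\<close>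

lemma star_poly_three_poles:
  fixes s :: real
  assumes n: "n \<ge> 4"
  defines "d \<equiv> (\<lambda>j. if j = 1 then 0 else if j = n - 1 then 1 else - 1)"
    and "c \<equiv> (\<lambda>j. if j = 1 then 1 else if j = n - 1 then - 9 / 4 * (2 + s) else (2 - s) / 4 / (real n - 3))"
  shows "star_poly (- 5 / 2 - s) d c {1..<n} = ([:1, 1:] ^ (n - 4) * [:1 / 2, 1:] * [:2, 1:]) * [:1, s, 1:]"
proof -
  have fib: "{j \<in> {1..<n}. d j = 0} = {1}" "{j \<in> {1..<n}. d j = 1} = {n - 1}"
    "{j \<in> {1..<n}. d j = - 1} = {2..<n - 1}"
    using n by (auto simp: d_def)
  have "2 < n - 1" using n by linarith
  have "d ` {1..<n} = insert (d 1) (insert (d (n - 1)) (d ` {2..<n - 1}))"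
    using n unfolding image_insert[symmetric] by (intro arg_cong[of _ _ "image d"]) auto
  also have "d ` {2..<n - 1} = (\<lambda>_. - 1) ` {2..<n - 1}" by (intro image_cong) (auto simp: d_def)
  also have "d (n - 1) = 1" using n by (simp add: d_def)
  also have "d 1 = 0" by (simp add: d_def)
  finally have img: "d ` {1..<n} = {0, 1, - 1}" using \<open>2 < n - 1\<close> by (simp add: image_constant_conv)
  \<comment> \<open>The totals again come from the values of the target quartic at 0, 1 and -1, with
    n - 3 indices sharing the pole -1. Its roots -1/2 and -2 lie on either side of -1, which makes
    the weight there positive for \<open>s < 2\<close>.\<close>
  have sums: "sum c {1} = 1" "sum c {n - 1} = - 9 / 4 * (2 + s)" "sum c {2..<n - 1} = (2 - s) / 4"
    using n by (auto simp: c_def of_nat_diff field_simps)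
  define W where "W x = (\<Sum>j | j \<in> {1..<n} \<and> d j = x. c j)" for x
  have W: "W 0 = 1" "W 1 = - 9 / 4 * (2 + s)" "W (- 1) = (2 - s) / 4" unfolding W_def fib sums by (rule refl)+
  have quartic: "star_poly (- 5 / 2 - s) (\<lambda>x. x) W {0, 1, - 1} = [:1 / 2, 1:] * [:2, 1:] * [:1, s, 1:]"
    by (simp add: star_poly_def W insert_Diff_if field_simps)
  have "(\<Prod>x\<in>{0, 1, - 1 :: real}. [:- x, 1:] ^ (card {j \<in> {1..<n}. d j = x} - 1)) = [:1, 1:] ^ (n - 4)"
    using n by (subst prod.insert; (subst prod.insert)?; simp add: fib del: One_nat_def atLeastLessThan_iff)
  then show ?thesis
    unfolding star_poly_group[OF finite_atLeastLessThan] img W_def[symmetric] quartic by (simp only: mult.assoc)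
qed

lemma star_mat_refined_inertia:
  assumes "n > 0" "star_poly a d c {1..<n} = h * [:1, s, 1:]"
    and "\<And>x. poly (map_poly complex_of_real h) x = 0 \<Longrightarrow> Re x < 0"
  shows "refined_inertia (star_mat n a d c) =
    (if s < 0 then (2, n - 2, 0, 0) else if s = 0 then (0, n - 2, 0, 2) else (0, n, 0, 0))"
  using assms by (intro refined_inertia_split[of _ _ h 1]) (auto simp: char_poly_star_mat)

definition two_pole_mat :: "nat \<Rightarrow> real \<Rightarrow> real \<Rightarrow> real mat" where
  "two_pole_mat n r s = star_mat n (1 - r - s) (\<lambda>j. if j = 1 then 0 else - 1)
     (\<lambda>j. if j = 1 then - r else (r - 1) * (2 - s) / (real n - 2))"

definition three_pole_mat :: "nat \<Rightarrow> real \<Rightarrow> real mat" where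
  "three_pole_mat n s = star_mat n (- 5 / 2 - s) (\<lambda>j. if j = 1 then 0 else if j = n - 1 then 1 else - 1)
     (\<lambda>j. if j = 1 then 1 else if j = n - 1 then - 9 / 4 * (2 + s) else (2 - s) / 4 / (real n - 3))"

lemma two_pole_mat_refined_inertia:
  assumes "n \<ge> 4" "r > 0"
  shows "refined_inertia (two_pole_mat n r s) =
    (if s < 0 then (2, n - 2, 0, 0) else if s = 0 then (0, n - 2, 0, 2) else (0, n, 0, 0))"
  unfolding two_pole_mat_def
proof (rule star_mat_refined_inertia[OF _ star_poly_two_poles[OF assms(1)]])
  fix x assume "poly (map_poly complex_of_real ([:1, 1:] ^ (n - 3) * [:r, 1:])) x = 0"
  then have "poly (map_poly complex_of_real [:1, 1:]) x = 0 \<or> poly (map_poly complex_of_real [:r, 1:]) x = 0"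
    unfolding of_real_poly_hom.hom_mult of_real_poly_hom.hom_power poly_mult poly_power
      mult_eq_0_iff power_eq_0_iff by blast
  then show "Re x < 0" using assms by (auto simp: map_poly_pCons complex_eq_iff)
qed (use assms in auto)

lemma three_pole_mat_refined_inertia:
  assumes "n \<ge> 4"
  shows "refined_inertia (three_pole_mat n s) =
    (if s < 0 then (2, n - 2, 0, 0) else if s = 0 then (0, n - 2, 0, 2) else (0, n, 0, 0))"
  unfolding three_pole_mat_def
proof (rule star_mat_refined_inertia[OF _ star_poly_three_poles[OF assms(1)]])
  fix x assume "poly (map_poly complex_of_real ([:1, 1:] ^ (n - 4) * [:1 / 2, 1:] * [:2, 1:])) x = 0"
  then have "poly (map_poly complex_of_real [:1, 1:]) x = 0 \<or> poly (map_poly complex_of_real [:1 / 2, 1:]) x = 0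
      \<or> poly (map_poly complex_of_real [:2, 1:]) x = 0"
    unfolding of_real_poly_hom.hom_mult of_real_poly_hom.hom_power poly_mult poly_power
      mult_eq_0_iff power_eq_0_iff by blast
  then show "Re x < 0" by (auto simp: map_poly_pCons complex_eq_iff)
qed (use assms in auto)

theorem theorem3p9:
  fixes n :: nat
  assumes "n \<ge> 4"
  shows "requires_ri (A1 n) (H_set n) \<and> requires_ri (A2 n) (H_set n) \<and> requires_ri (A3 n) (H_set n)"
proof (intro conjI requires_ri_H_setI)
  fix s :: real assume s: "\<bar>s\<bar> \<le> 1 / 4"
  let ?ri = "if s < 0 then (2, n - 2, 0, 0) else if s = 0 then (0, n - 2, 0, 2) else (0, n, 0, 0)"
  \<comment> \<open>A value \<open>r < 1\<close> makes the weights at -1 negative; for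
    \<open>r = 1 / 2\<close> the corner \<open>1 / 2 - s\<close> is positive.\<close>
  have "two_pole_mat n (1 / 2) s \<in> qual_class (A1 n)" unfolding qual_class_iff[OF A_carrier(1)]
    using assms s by (auto simp: two_pole_mat_def star_mat_def A1_def mult_less_0_iff divide_less_0_iff)
  then show "\<exists>B\<in>qual_class (A1 n). refined_inertia B = ?ri"
    using two_pole_mat_refined_inertia[of n "1 / 2" s] assms by (intro bexI) auto
  \<comment> \<open>A value \<open>r > 1\<close> makes the weights at -1 positive; for
    \<open>r = 2\<close> the corner \<open>- 1 - s\<close> is negative.\<close>
  have "two_pole_mat n 2 s \<in> qual_class (A2 n)" unfolding qual_class_iff[OF A_carrier(2)]
    using assms s by (auto simp: two_pole_mat_def star_mat_def A2_def)
  then show "\<exists>B\<in>qual_class (A2 n). refined_inertia B = ?ri"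
    using two_pole_mat_refined_inertia[of n 2 s] assms by (intro bexI) auto
  have "three_pole_mat n s \<in> qual_class (A3 n)" unfolding qual_class_iff[OF A_carrier(3)]
    using assms s by (auto simp: three_pole_mat_def star_mat_def A3_def)
  then show "\<exists>B\<in>qual_class (A3 n). refined_inertia B = ?ri"
    using three_pole_mat_refined_inertia[of n s] assms by (intro bexI) auto
qed (use assms A1_refined_inertia A2_refined_inertia A3_refined_inertia in auto)

end
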